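(* Let $A=[A(i_1,\ldots,i_d)]$ be a tensor, and let $\mathcal I^{\leq k},\mathcal I^{>k}$, $k=1,\ldots,d-1$, be interpolation sets with $r_k$ elements each such that every $A_k=[A(\mathcal I^{\leq k},\mathcal I^{>k})]$ is nonsingular and both families are nested: for all valid $k$, $$i_{>k}\in\mathcal I^{>k}\Rightarrow i_{>k+1}\in\mathcal I^{>k+1},\qquad i_{\leq k}\in\mathcal I^{\leq k}\Rightarrow i_{\leq k-1}\in\mathcal I^{\leq k-1}.$$ Then the tensor train cross interpolation $\tilde A$ of $A$ on these sets is exact at the positions of all entries of $A$ that it uses: $$A(\mathcal I^{\leq k-1},i_k,\mathcal I^{>k})=\tilde A(\mathcal I^{\leq k-1},i_k,\mathcal I^{>k}),\qquad k=1,\ldots,d,$$ i.e. $A(i_1,\ldots,i_d)=\tilde A(i_1,\ldots,i_d)$ whenever, for some $k\in\{1,\ldots,d\}$, $i_{\leq k-1}\in\mathcal I^{\leq k-1}$, $i_{>k}\in\mathcal I^{>k}$ and $i_k$ is arbitrary (with no condition from $\mathcal I^{\leq0}$ or $\mathcal I^{>d}$).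
   Context: Tensors are real or complex arrays with indices $i_k\in\{1,\ldots,n_k\}$, $k=1,\ldots,d$. Multi-indices: $i_{\leq k}=(i_1,\ldots,i_k)$, $i_{>k}=(i_{k+1},\ldots,i_d)$. Interpolation sets: $\mathcal I^{\leq k}=\{\mathcal I^{\leq k}_1,\ldots,\mathcal I^{\leq k}_{r_k}\}$ is a set of $r_k$ distinct left multi-indices $i_{\leq k}$ and $\mathcal I^{>k}=\{\mathcal I^{>k}_1,\ldots,\mathcal I^{>k}_{r_k}\}$ a set of $r_k$ distinct right multi-indices $i_{>k}$; $\mathcal I^{\leq 0}$ and $\mathcal I^{>d}$ are empty (no index restriction), so the nestedness conditions are nontrivial for $1\le k\le d-2$ (right sets) and $2\le k\le d-1$ (left sets). $A_k=[A(\mathcal I^{\leq k}_{s},\mathcal I^{>k}_{t})]_{s,t=1}^{r_k}$ and $B^{[k]}=A_k^{-1}$. The tensor train cross interpolation on these sets is $$\tilde A(i_1,\ldots,i_d)=\sum_{s_1,\ldots,s_{d-1}}\sum_{t_1,\ldots,t_{d-1}}A(i_1,\mathcal I^{>1}_{t_1})\prod_{k=1}^{d-1}B^{[k]}_{t_k,s_k}\,A(\mathcal I^{\leq k}_{s_k},i_{k+1},\mathcal I^{>k+1}_{t_{k+1}}),$$ where $s_k,t_k$ run over $1,\ldots,r_k$ and for $k=d-1$ the last factor is $A(\mathcal I^{\leq d-1}_{s_{d-1}},i_d)$. *)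

theory Defs
  imports "Jordan_Normal_Form.Gauss_Jordan_Elimination" "HOL-Library.FuncSet"
begin

text \<open>
  A multi-index \<open>(i\<^sub>1, \<dots>, i\<^sub>d)\<close> is the list \<open>[i\<^sub>1, \<dots>, i\<^sub>d]\<close>, so \<open>i\<^sub>k\<close> is \<open>i ! (k - 1)\<close>,
  the left part \<open>(i\<^sub>1, \<dots>, i\<^sub>k)\<close> is \<open>take k i\<close> and the right part \<open>(i\<^sub>k\<^sub>+\<^sub>1, \<dots>, i\<^sub>d)\<close> is
  \<open>drop k i\<close>.  The index values are 1-based: \<open>i\<^sub>k \<in> {1..n k}\<close>.  A tensor is a function on
  such lists; its values at lists that are not valid multi-indices play no role.

  \<open>multi_indices n l m\<close> is the set of multi-indices \<open>(i\<^sub>l\<^sub>+\<^sub>1, \<dots>, i\<^sub>m)\<close>.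
\<close>

definition multi_indices :: "(nat \<Rightarrow> nat) \<Rightarrow> nat \<Rightarrow> nat \<Rightarrow> nat list set" where
  "multi_indices n l m =
     {x. length x = m - l \<and> (\<forall>j < m - l. x ! j \<in> {1..n (l + j + 1)})}"

text \<open>
  \<open>L k\<close> and \<open>R k\<close> enumerate the \<open>r k\<close> left multi-indices \<open>(i\<^sub>1, \<dots>, i\<^sub>k)\<close> and the \<open>r k\<close>
  right multi-indices \<open>(i\<^sub>k\<^sub>+\<^sub>1, \<dots>, i\<^sub>d)\<close> chosen at position \<open>k\<close>, for \<open>1 \<le> k \<le> d - 1\<close>.
  The positions in these enumerations are 0-based, as are the rows and columns of matrices.
\<close>

definition interpolation_sets ::
  "nat \<Rightarrow> (nat \<Rightarrow> nat) \<Rightarrow> (nat \<Rightarrow> nat) \<Rightarrow> (nat \<Rightarrow> nat list list) \<Rightarrow> (nat \<Rightarrow> nat list list) \<Rightarrow> bool"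
where
  "interpolation_sets d n r L R \<longleftrightarrow>
     (\<forall>k\<in>{1..<d}.
        length (L k) = r k \<and> distinct (L k) \<and> set (L k) \<subseteq> multi_indices n 0 k \<and>
        length (R k) = r k \<and> distinct (R k) \<and> set (R k) \<subseteq> multi_indices n k d)"

definition cross_matrix ::
  "(nat list \<Rightarrow> 'a) \<Rightarrow> (nat \<Rightarrow> nat) \<Rightarrow> (nat \<Rightarrow> nat list list) \<Rightarrow> (nat \<Rightarrow> nat list list) \<Rightarrow> nat \<Rightarrow> 'a mat"
where
  "cross_matrix A r L R k = mat (r k) (r k) (\<lambda>(s, t). A (L k ! s @ R k ! t))"

text \<open>\<open>mat_inverse\<close> is \<open>None\<close> on singular matrices, where the value below is arbitrary.\<close>

definition cross_inverse ::
  "(nat list \<Rightarrow> 'a::field) \<Rightarrow> (nat \<Rightarrow> nat) \<Rightarrow> (nat \<Rightarrow> nat list list) \<Rightarrow> (nat \<Rightarrow> nat list list) \<Rightarrow> nat \<Rightarrow> 'a mat"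
where
  "cross_inverse A r L R k = the (mat_inverse (cross_matrix A r L R k))"

text \<open>
  The \<open>t\<close>-th right multi-index at position \<open>k\<close>; at \<open>k = d\<close> there are no indices to the
  right, so it is empty and does not depend on \<open>t\<close>.
\<close>

definition right_part :: "nat \<Rightarrow> (nat \<Rightarrow> nat list list) \<Rightarrow> nat \<Rightarrow> nat \<Rightarrow> nat list" where
  "right_part d R k t = (if k = d then [] else R k ! t)"

definition tt_cross ::
  "nat \<Rightarrow> (nat \<Rightarrow> nat) \<Rightarrow> (nat list \<Rightarrow> 'a::field) \<Rightarrow> (nat \<Rightarrow> nat list list) \<Rightarrow> (nat \<Rightarrow> nat list list) \<Rightarrow>
     nat list \<Rightarrow> 'a"
where
  "tt_cross d r A L R i =
     (\<Sum>s \<in> PiE {1..<d} (\<lambda>k. {..<r k}). \<Sum>t \<in> PiE {1..<d} (\<lambda>k. {..<r k}).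
        A (i ! 0 # right_part d R 1 (t 1)) *
        (\<Prod>k = 1..<d. cross_inverse A r L R k $$ (t k, s k) *
           A (L k ! s k @ i ! k # right_part d R (k + 1) (t (k + 1)))))"

end

theory Submission
  imports Defs
begin

text \<open>
  Contract the tensor train from the left, leaving the summation index \<open>t\<^sub>m\<close> open.  If
  \<open>(i\<^sub>1, \<dots>, i\<^sub>m)\<close> is one of the left interpolation indices, the partial contraction at \<open>m\<close>
  is a row of \<open>A\<^sub>m\<close>, so multiplying by \<open>A\<^sub>m\<^sup>-\<^sup>1\<close> selects a single summand and the
  contraction at \<open>m + 1\<close> is again a section of \<open>A\<close>.  If instead \<open>(i\<^sub>m\<^sub>+\<^sub>1, \<dots>, i\<^sub>d)\<close> is the
  right interpolation index number \<open>t\<close>, the next factor is a column of \<open>A\<^sub>m\<close>, so the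
  contraction at \<open>m + 1\<close> equals the one at \<open>m\<close> evaluated at \<open>t\<close>.  By nestedness the first
  case applies at all \<open>m < k\<close> and the second at all \<open>m \<ge> k\<close>.
\<close>

lemma sum_PiE_insert:
  assumes "x \<notin> S"
  shows "(\<Sum>f\<in>PiE (insert x S) T. F f) = (\<Sum>y\<in>T x. \<Sum>f\<in>PiE S T. F (f(x := y)))"
proof -
  have "(\<Sum>f\<in>PiE (insert x S) T. F f) = (\<Sum>(y, f)\<in>T x \<times> PiE S T. F (f(x := y)))"
    unfolding PiE_insert_eq
    by (subst sum.reindex[OF inj_combinator[OF assms]]) (simp add: o_def case_prod_beta')
  then show ?thesis
    by (simp add: sum.cartesian_product)
qed

text \<open>The partial contraction with abstract cores \<open>g\<close> and \<open>h\<close>. The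
  functions in \<open>PiE\<close> are fixed only below \<open>m\<close>, so the open index
  \<open>u\<close> is written in at \<open>m\<close>; for \<open>m = 1\<close> this leaves just
  \<open>g u\<close>.\<close>

definition chain_sum ::
  "(nat \<Rightarrow> nat) \<Rightarrow> (nat \<Rightarrow> 'a::comm_semiring_1) \<Rightarrow> (nat \<Rightarrow> nat \<Rightarrow> nat \<Rightarrow> nat \<Rightarrow> 'a) \<Rightarrow> nat \<Rightarrow> nat \<Rightarrow> 'a"
where
  "chain_sum r g h m u =
     (\<Sum>s \<in> PiE {1..<m} (\<lambda>k. {..<r k}). \<Sum>t \<in> PiE {1..<m} (\<lambda>k. {..<r k}).
        g ((t(m := u)) 1) *
        (\<Prod>k = 1..<m. h k ((t(m := u)) k) (s k) ((t(m := u)) (k + 1))))"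

lemma chain_sum_1: "chain_sum r g h 1 u = g u"
  by (simp add: chain_sum_def)

text \<open>Split off the values \<open>a\<close> of \<open>s\<close> and \<open>b\<close> of
  \<open>t\<close> at position \<open>m\<close>. Factors with k < m see \<open>t\<close> only up to
  \<open>m\<close>, so the update at \<open>Suc m\<close> is invisible to them and \<open>b\<close>
  becomes the open index of the shorter chain.\<close>

lemma chain_sum_Suc:
  assumes "1 \<le> m"
  shows "chain_sum r g h (Suc m) u =
    (\<Sum>b<r m. chain_sum r g h m b * (\<Sum>a<r m. h m b a u))"
proof -
  let ?P = "PiE {1..<m} (\<lambda>k. {..<r k})"
  let ?T = "\<lambda>s t b. g ((t(m := b)) 1) *
    (\<Prod>k = 1..<m. h k ((t(m := b)) k) (s k) ((t(m := b)) (k + 1)))"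
  have ins: "{1..<Suc m} = insert m {1..<m}" and notin: "m \<notin> {1..<m}"
    using assms by auto
  have summand: "g ((t(m := b, Suc m := u)) 1) *
      (\<Prod>k = 1..<Suc m. h k ((t(m := b, Suc m := u)) k) ((s(m := a)) k)
        ((t(m := b, Suc m := u)) (k + 1))) = ?T s t b * h m b a u" for s t a b
  proof -
    have "(\<Prod>k = 1..<m. h k ((t(m := b, Suc m := u)) k) ((s(m := a)) k)
        ((t(m := b, Suc m := u)) (k + 1))) =
      (\<Prod>k = 1..<m. h k ((t(m := b)) k) (s k) ((t(m := b)) (k + 1)))"
      by (rule prod.cong) auto
    then show ?thesis
      using assms unfolding ins by (simp add: mult_ac)
  qed
  have "chain_sum r g h (Suc m) u =
      (\<Sum>a<r m. \<Sum>s\<in>?P. \<Sum>b<r m. \<Sum>t\<in>?P. ?T s t b * h m b a u)"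
    unfolding chain_sum_def
    by (subst (1 2) ins) (simp only: sum_PiE_insert[OF notin] summand)
  also have "\<dots> = (\<Sum>a<r m. \<Sum>b<r m. \<Sum>s\<in>?P. \<Sum>t\<in>?P. ?T s t b * h m b a u)"
    by (intro sum.cong refl sum.swap)
  also have "\<dots> = (\<Sum>b<r m. \<Sum>a<r m. \<Sum>s\<in>?P. \<Sum>t\<in>?P. ?T s t b * h m b a u)"
    by (rule sum.swap)
  also have "\<dots> = (\<Sum>b<r m. chain_sum r g h m b * (\<Sum>a<r m. h m b a u))"
    unfolding chain_sum_def sum_distrib_left sum_distrib_right ..
  finally show ?thesis .
qed

text \<open>Any \<open>u\<close> will do: \<open>right_part\<close> ignores its last argument at
  \<open>d\<close>, the one place where \<open>t(d := u)\<close> differs from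
  \<open>t\<close>.\<close>

lemma tt_cross_eq_chain_sum:
  assumes "1 \<le> d"
  shows "tt_cross d r A L R i =
    chain_sum r (\<lambda>t. A (i ! 0 # right_part d R 1 t))
      (\<lambda>k t s t'. cross_inverse A r L R k $$ (t, s) *
         A (L k ! s @ i ! k # right_part d R (k + 1) t')) d u"
proof -
  have right: "right_part d R k ((t(d := u)) k) = right_part d R k (t k)" for k t
    by (simp add: right_part_def)
  show ?thesis
    unfolding tt_cross_def chain_sum_def right
    by (intro sum.cong refl arg_cong2[of _ _ _ _ "(*)"] prod.cong) auto
qed

text \<open>Bridges \<open>invertible_mat\<close>, which does not mention the size of the inverse,
  and \<open>mat_inverse\<close>, which is characterised by the units of the matrix ring.\<close>

lemma mat_inverse_invertible:
  fixes M :: "'a::field mat"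
  assumes M: "M \<in> carrier_mat n n" and inv: "invertible_mat M"
  shows "the (mat_inverse M) \<in> carrier_mat n n"
    and "M * the (mat_inverse M) = 1\<^sub>m n"
    and "the (mat_inverse M) * M = 1\<^sub>m n"
proof -
  obtain B where B: "inverts_mat M B" "inverts_mat B M"
    using inv unfolding invertible_mat_def by blast
  \<comment> \<open>Comparing dimensions: M B = 1 fixes the columns of B, and B M = 1 its
    rows.\<close>
  have "B \<in> carrier_mat n n"
    using B M unfolding inverts_mat_def
    by (metis carrier_matD carrier_matI index_mult_mat(2,3) index_one_mat(2,3))
  then have "M \<in> Units (ring_mat TYPE('a) n ())"
    using B M unfolding inverts_mat_def Units_def ring_mat_def by auto
  then obtain C where "mat_inverse M = Some C"
    using mat_inverse(1)[OF M] by (metis option.exhaust)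
  then show "the (mat_inverse M) \<in> carrier_mat n n"
    and "M * the (mat_inverse M) = 1\<^sub>m n"
    and "the (mat_inverse M) * M = 1\<^sub>m n"
    using mat_inverse(2)[OF M] by auto
qed

lemma index_mult_mat_sum:
  assumes "M \<in> carrier_mat n n" "N \<in> carrier_mat n n" "p < n" "q < n"
  shows "(M * N) $$ (p, q) = (\<Sum>j<n. M $$ (p, j) * N $$ (j, q))"
  using assms by (auto simp: scalar_prod_def atLeast0LessThan intro!: sum.cong)

lemma cross_inverse_sums:
  fixes A :: "nat list \<Rightarrow> 'a::field"
  assumes "invertible_mat (cross_matrix A r L R k)" and "p < r k" "q < r k"
  shows "(\<Sum>t<r k. A (L k ! p @ R k ! t) * cross_inverse A r L R k $$ (t, q)) =
      (if p = q then 1 else 0)"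
    and "(\<Sum>s<r k. cross_inverse A r L R k $$ (p, s) * A (L k ! s @ R k ! q)) =
      (if p = q then 1 else 0)"
proof -
  let ?M = "cross_matrix A r L R k"
  have M: "?M \<in> carrier_mat (r k) (r k)"
    by (simp add: cross_matrix_def)
  have entry: "?M $$ (s, t) = A (L k ! s @ R k ! t)" if "s < r k" "t < r k" for s t
    using that by (simp add: cross_matrix_def)
  note inv = mat_inverse_invertible[OF M assms(1), folded cross_inverse_def]
  show "(\<Sum>t<r k. A (L k ! p @ R k ! t) * cross_inverse A r L R k $$ (t, q)) =
      (if p = q then 1 else 0)"
    using index_mult_mat_sum[OF M inv(1) assms(2,3)] inv(2) assms(2,3) entry by simp
  show "(\<Sum>s<r k. cross_inverse A r L R k $$ (p, s) * A (L k ! s @ R k ! q)) =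
      (if p = q then 1 else 0)"
    using index_mult_mat_sum[OF inv(1) M assms(2,3)] inv(3) assms(2,3) entry by simp
qed

theorem theorem4:
  fixes A :: "nat list \<Rightarrow> 'a::field"
    and d :: nat
    and n r :: "nat \<Rightarrow> nat"
    and L R :: "nat \<Rightarrow> nat list list"
  assumes sets: "interpolation_sets d n r L R"
    and nonsingular: "\<And>k. k \<in> {1..<d} \<Longrightarrow> invertible_mat (cross_matrix A r L R k)"
    and right_nested:
      "\<And>k x. 1 \<le> k \<Longrightarrow> k + 2 \<le> d \<Longrightarrow> x \<in> set (R k) \<Longrightarrow> tl x \<in> set (R (k + 1))"
    and left_nested:
      "\<And>k x. 2 \<le> k \<Longrightarrow> k + 1 \<le> d \<Longrightarrow> x \<in> set (L k) \<Longrightarrow> butlast x \<in> set (L (k - 1))"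
  shows "\<forall>i k. i \<in> multi_indices n 0 d \<longrightarrow> k \<in> {1..d} \<longrightarrow>
           (k = 1 \<or> take (k - 1) i \<in> set (L (k - 1))) \<longrightarrow>
           (k = d \<or> drop k i \<in> set (R k)) \<longrightarrow>
           A i = tt_cross d r A L R i"
proof (intro allI impI)
  fix i k
  assume i: "i \<in> multi_indices n 0 d" and k: "k \<in> {1..d}"
    and left: "k = 1 \<or> take (k - 1) i \<in> set (L (k - 1))"
    and right: "k = d \<or> drop k i \<in> set (R k)"
  have len: "length i = d"
    using i by (simp add: multi_indices_def)
  have len_LR: "length (L m) = r m" "length (R m) = r m" if "1 \<le> m" "m < d" for m
    using sets that by (auto simp: interpolation_sets_def)
  let ?B = "cross_inverse A r L R"
  let ?X = "\<lambda>m s t. A (L m ! s @ i ! m # right_part d R (m + 1) t)"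
  define F where "F = chain_sum r (\<lambda>t. A (i ! 0 # right_part d R 1 t))
    (\<lambda>m t s t'. ?B m $$ (t, s) * ?X m s t')"
  have tt: "tt_cross d r A L R i = F d u" for u
    unfolding F_def using k by (intro tt_cross_eq_chain_sum) simp
  have F_Suc: "F (Suc m) u = (\<Sum>t<r m. F m t * (\<Sum>s<r m. ?B m $$ (t, s) * ?X m s u))"
    if "1 \<le> m" for m u
    unfolding F_def using that by (rule chain_sum_Suc)

  \<comment> \<open>Downward induction from k - 1, dropping the last index each time.\<close>
  have left_mem: "m < k \<longrightarrow> take m i \<in> set (L m)" if "1 \<le> m" "m \<le> k - 1" for m
    using that(2,1)
  proof (induction m rule: inc_induct)
    case base
    then show ?case using left by auto
  next
    case (step m)
    have "butlast (take (Suc m) i) = take m i"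
      using step.hyps k len butlast_take[of "Suc m" i] by force
    then show ?case
      using left_nested[of "Suc m" "take (Suc m) i"] step k by auto
  qed
  \<comment> \<open>Upward induction, dropping the first index; the guard makes k = d
    vacuous.\<close>
  have right_mem: "m < d \<longrightarrow> drop m i \<in> set (R m)" if "k \<le> m" for m
    using that
  proof (induction m rule: dec_induct)
    case base
    then show ?case using right by auto
  next
    case (step m)
    then show ?case
      using right_nested[of m "drop m i"] k by (auto simp: drop_Suc tl_drop)
  qed

  have F_left: "m \<le> k \<longrightarrow> F m u = A (take m i @ right_part d R m u)" if "1 \<le> m" for m u
    using that
  proof (induction m arbitrary: u rule: dec_induct)
    case base
    have "take 1 i = [i ! 0]"
      using k len by (cases i) auto
    then show ?case
      unfolding F_def by (simp only: chain_sum_1 append_Cons append_Nil simp_thms)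
  next
    case (step m)
    show ?case
    proof
      assume m: "Suc m \<le> k"
      then have md: "m < d" and "m \<le> k - 1" using k by auto
      obtain p where p: "p < r m" "L m ! p = take m i"
        using left_mem[of m] \<open>m \<le> k - 1\<close> m step.hyps len_LR[of m] md
        by (auto simp: in_set_conv_nth)
      \<comment> \<open>By the induction hypothesis and m < d, \<open>F m t\<close> is entry
        \<open>t\<close> of row \<open>p\<close> of the cross matrix, so its product with the
        inverse is a unit vector.\<close>
      have row: "(\<Sum>t<r m. F m t * ?B m $$ (t, s)) = (if p = s then 1 else 0)"
        if "s < r m" for s
        using cross_inverse_sums(1)[OF nonsingular p(1) that] step m md p(2)
        by (simp add: right_part_def)
      have "F (Suc m) u = (\<Sum>t<r m. \<Sum>s<r m. F m t * ?B m $$ (t, s) * ?X m s u)"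
        using step.hyps by (simp add: F_Suc sum_distrib_left mult.assoc)
      also have "\<dots> = (\<Sum>s<r m. (\<Sum>t<r m. F m t * ?B m $$ (t, s)) * ?X m s u)"
        by (subst sum.swap) (simp add: sum_distrib_right)
      also have "\<dots> = (\<Sum>s<r m. if p = s then ?X m s u else 0)"
        by (intro sum.cong) (auto simp: row)
      also have "\<dots> = ?X m p u"
        using p(1) by simp
      also have "\<dots> = A (take (Suc m) i @ right_part d R (Suc m) u)"
        using p(2) md len by (simp add: take_Suc_conv_app_nth)
      finally show "F (Suc m) u = A (take (Suc m) i @ right_part d R (Suc m) u)" .
    qed
  qed

  \<comment> \<open>Only those \<open>u\<close> that select the right part of \<open>i\<close>
    itself are claimed. At m = d both sides of this condition are empty, so every \<open>u\<close>
    qualifies.\<close>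
  have F_right: "m \<le> d \<longrightarrow> right_part d R m u = drop m i \<longrightarrow> F m u = A i"
    if "k \<le> m" for m u
    using that
  proof (induction m arbitrary: u rule: dec_induct)
    case base
    show ?case
      using F_left[of k u] k by auto
  next
    case (step m)
    show ?case
    proof (intro impI)
      assume m: "Suc m \<le> d" and u: "right_part d R (Suc m) u = drop (Suc m) i"
      have m1: "1 \<le> m" using step.hyps k by simp
      obtain q where q: "q < r m" "R m ! q = drop m i"
        using right_mem[of m] m step.hyps len_LR[of m] m1
        by (auto simp: in_set_conv_nth)
      \<comment> \<open>Prepending index \<open>i ! m\<close> to \<open>drop (Suc m) i\<close> gives
        \<open>drop m i\<close>, so the factor is column \<open>q\<close> of the cross matrix and
        the sum over \<open>s\<close> is a unit vector in \<open>t\<close>.\<close>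
      have X: "?X m s u = A (L m ! s @ R m ! q)" for s
        using u q(2) m len by (simp add: Cons_nth_drop_Suc)
      have "F (Suc m) u = (\<Sum>t<r m. F m t * (if t = q then 1 else 0))"
        unfolding F_Suc[OF m1] X
        using m m1 by (intro sum.cong) (auto simp: cross_inverse_sums(2) nonsingular q(1))
      also have "\<dots> = F m q"
        using q(1) sum.remove[of "{..<r m}" q "\<lambda>t. F m t * (if t = q then 1 else 0)"] by simp
      also have "\<dots> = A i"
        using step.IH q m by (simp add: right_part_def)
      finally show "F (Suc m) u = A i" .
    qed
  qed
  show "A i = tt_cross d r A L R i"
    using F_right[of d] tt k len by (simp add: right_part_def)
qed

end
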